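(* Let $\Bbbk$ be an algebraically closed field and let $\alpha,\beta\in\Bbbk^{*}$. The two-parameter quantum matrix algebra $M_2(\alpha,\beta)$ is a PI algebra if and only if $\alpha$ and $\beta$ are roots of unity.
   Context: $M_2(\alpha,\beta)$ is the associative unital $\Bbbk$-algebra generated by $X_{11},X_{12},X_{21},X_{22}$ subject to the relations $$X_{12}X_{11}=\alpha X_{11}X_{12},\quad X_{22}X_{21}=\alpha X_{21}X_{22},\quad X_{21}X_{11}=\beta X_{11}X_{21},\quad X_{22}X_{12}=\beta X_{12}X_{22},$$ $$X_{21}X_{12}=\beta\alpha^{-1}X_{12}X_{21},\quad X_{22}X_{11}-X_{11}X_{22}=(\beta-\alpha^{-1})X_{12}X_{21}.$$ An algebra $A$ is a PI algebra if its underlying ring satisfies a monic polynomial identity, i.e. there is a monic (some monomial of highest degree has coefficient $1$) polynomial $g\in\mathbb{Z}\langle x_1,\ldots,x_m\rangle$ with $g(a_1,\ldots,a_m)=0$ for all $a_1,\ldots,a_m\in A$. For an algebra over a field $\Bbbk$ this is equivalent to satisfying a nonzero polynomial identity in $\Bbbk\langle x_1,\ldots,x_m\rangle$. *)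

theory Defs
  imports
    "HOL-Library.Poly_Mapping"
    "HOL-Algebra.QuotRing"
    "HOL-Algebra.Algebraic_Closure_Type"
begin

text \<open>
  The multiplication of \<^typ>\<open>'a \<Rightarrow>\<^sub>0 'b\<close> is convolution with respect to addition on
  \<^typ>\<open>'a\<close>. The free monoid is therefore written additively (although it is not commutative),
  with concatenation as addition and the empty word as zero.
\<close>

datatype 'x free_monoid = Word (letters: "'x list")

instantiation free_monoid :: (type) monoid_add
begin

definition zero_free_monoid :: "'a free_monoid"
  where "0 = Word []"

definition plus_free_monoid :: "'a free_monoid \<Rightarrow> 'a free_monoid \<Rightarrow> 'a free_monoid"
  where "u + v = Word (letters u @ letters v)"

instance
  by standard (simp_all add: zero_free_monoid_def plus_free_monoid_def)

end

text \<open>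
  \<open>('x, 'r) free_algebra\<close> is the free algebra on the letters \<open>'x\<close> with coefficients in \<open>'r\<close>:
  finite formal linear combinations of words. Its \<open>'r\<close>-algebra structure is given by the
  embedding \<open>scalar\<close> of the coefficients as multiples of the empty word.
\<close>

type_synonym ('x, 'r) free_algebra = "'x free_monoid \<Rightarrow>\<^sub>0 'r"

definition scalar :: "'r :: zero \<Rightarrow> ('x, 'r) free_algebra"
  where "scalar c = Poly_Mapping.single 0 c"

definition letter :: "'x \<Rightarrow> ('x, 'r :: zero_neq_one) free_algebra"
  where "letter x = Poly_Mapping.single (Word [x]) 1"

datatype generator = G11 | G12 | G21 | G22

text \<open>Each relation \<open>p = q\<close> is represented by the element \<open>p - q\<close>.\<close>

definition M2_relations :: "'k :: Fields.field \<Rightarrow> 'k \<Rightarrow> (generator, 'k) free_algebra set"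
  where "M2_relations \<alpha> \<beta> =
    (let X11 = letter G11; X12 = letter G12; X21 = letter G21; X22 = letter G22 in
      {X12 * X11 - scalar \<alpha> * X11 * X12,
       X22 * X21 - scalar \<alpha> * X21 * X22,
       X21 * X11 - scalar \<beta> * X11 * X21,
       X22 * X12 - scalar \<beta> * X12 * X22,
       X21 * X12 - scalar (\<beta> * inverse \<alpha>) * X12 * X21,
       (X22 * X11 - X11 * X22) - scalar (\<beta> - inverse \<alpha>) * X12 * X21})"

text \<open>
  \<^const>\<open>genideal\<close> is the two-sided ideal generated by a set. Since the scalars are elements of
  the free algebra, every ideal of the underlying ring is a linear subspace.
\<close>

definition M2 :: "'k :: Fields.field \<Rightarrow> 'k \<Rightarrow> (generator, 'k) free_algebra set ring"
  where "M2 \<alpha> \<beta> =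
    (let F = (ring_of_type_algebra :: (generator, 'k) free_algebra ring)
      in F Quot (Idl\<^bsub>F\<^esub> (M2_relations \<alpha> \<beta>)))"

definition word_eval :: "('a, 'b) ring_scheme \<Rightarrow> ('x \<Rightarrow> 'a) \<Rightarrow> 'x free_monoid \<Rightarrow> 'a"
  where "word_eval R a w = foldr (\<otimes>\<^bsub>R\<^esub>) (map a (letters w)) \<one>\<^bsub>R\<^esub>"

definition nc_eval :: "('a, 'b) ring_scheme \<Rightarrow> ('x \<Rightarrow> 'a) \<Rightarrow> ('x, int) free_algebra \<Rightarrow> 'a"
  where "nc_eval R a g =
    (\<Oplus>\<^bsub>R\<^esub> w \<in> Poly_Mapping.keys g. [Poly_Mapping.lookup g w] \<cdot>\<^bsub>R\<^esub> word_eval R a w)"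

definition nc_monic :: "('x, int) free_algebra \<Rightarrow> bool"
  where "nc_monic g \<longleftrightarrow>
    (\<exists>w \<in> Poly_Mapping.keys g. Poly_Mapping.lookup g w = 1 \<and>
       (\<forall>v \<in> Poly_Mapping.keys g. length (letters v) \<le> length (letters w)))"

text \<open>The variable \<open>x\<^sub>i\<close> is represented by the letter \<open>i\<close>, so the condition on its words says
  \<open>g \<in> \<int>\<langle>x\<^sub>1, \<dots>, x\<^sub>m\<rangle>\<close>.\<close>

definition PI_ring :: "('a, 'b) ring_scheme \<Rightarrow> bool"
  where "PI_ring R \<longleftrightarrow>
    ring R \<and>
    (\<exists>(m :: nat) (g :: (nat, int) free_algebra).
       (\<forall>w \<in> Poly_Mapping.keys g. set (letters w) \<subseteq> {1..m}) \<and>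
       nc_monic g \<and>
       (\<forall>a. (\<forall>i \<in> {1..m}. a i \<in> carrier R) \<longrightarrow> nc_eval R a g = \<zero>\<^bsub>R\<^esub>))"

lemma ring_free_algebra: "ring (ring_of_type_algebra :: ('x, 'r :: ring_1) free_algebra ring)"
proof -
  have "\<exists>y. x + y = 0" for x :: "('x, 'r) free_algebra"
    using add.right_inverse by blast
  thus ?thesis
    unfolding ring_of_type_algebra_def using add.right_inverse
    by unfold_locales (auto simp: algebra_simps Units_def)
qed

lemma ring_M2: "ring (M2 \<alpha> \<beta>)"
proof -
  interpret F: ring "ring_of_type_algebra :: (generator, 'a) free_algebra ring"
    by (rule ring_free_algebra)
  have "ideal (Idl\<^bsub>ring_of_type_algebra\<^esub> (M2_relations \<alpha> \<beta>)) ring_of_type_algebra"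
    by (rule F.genideal_ideal) (simp add: ring_of_type_algebra_def)
  thus ?thesis
    by (simp add: M2_def ideal.quotient_is_ring)
qed

lemma letter_mult: "letter x * letter y = Poly_Mapping.single (Word [x, y]) (1 :: 'r :: ring_1)"
  by (simp add: letter_def mult_single plus_free_monoid_def)

lemma nc_eval_letter:
  assumes "ring R" "a x \<in> carrier R"
  shows "nc_eval R a (letter x) = a x"
proof -
  interpret ring R by fact
  show ?thesis
    using assms(2) by (simp add: nc_eval_def word_eval_def letter_def add_pow_int_ge)
qed

end

theory Submission
  imports Defs "HOL-Combinatorics.Permutations"
begin

text \<open>
  Suppose first that \<open>\<alpha> ^ n = \<beta> ^ n = 1\<close> with \<open>n > 0\<close>. Then the \<open>n\<close>-th powers of all four
  generators are central in \<open>M\<^sub>2(\<alpha>, \<beta>)\<close>. Only the commutation of \<open>X11\<close> and \<open>X22\<close> needs an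
  argument: the commutator of \<open>X22\<close> with \<open>X11 ^ n\<close> is \<open>X11 ^ (n - 1) * X12 * X21\<close> times
  \<open>inverse \<alpha> * ((\<alpha> * \<beta>) ^ n - 1) = 0\<close>, and similarly for \<open>X11\<close> and \<open>X22 ^ n\<close>. By the relations
  the algebra is spanned by the monomials \<open>X11 ^ a * X12 ^ b * X21 ^ c * X22 ^ d\<close>, hence
  it is generated by the \<open>n ^ 4\<close> monomials with exponents below \<open>n\<close> as a module over a central subring. A ring generated by \<open>r\<close> elements over a
  central subring satisfies the standard identity
  \<open>\<Sum>p. sign p * x (p 1) * \<dots> * x (p (r + 1))\<close>, which is multilinear over the centre and alternating
  (\<open>PI_ring_quotient_if_finite_over_center\<close>).

  Conversely, \<open>M\<^sub>2(\<alpha>, \<beta>)\<close> becomes the quantum plane \<open>X12 * X11 = \<alpha> * X11 * X12\<close> when \<open>X21\<close> and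
  \<open>X22\<close> are set to \<open>0\<close>, and the quantum plane \<open>X21 * X11 = \<beta> * X11 * X21\<close> when \<open>X12\<close> and \<open>X22\<close>
  are set to \<open>0\<close>. So it suffices that the quantum plane \<open>y * x = q * x * y\<close> has no monic identity if
  \<open>q\<close> is not a root of unity. It acts on \<open>k[t]\<close>, with \<open>x\<close> as multiplication by \<open>t\<close> and \<open>y\<close> as the
  substitution of \<open>q * t\<close> for \<open>t\<close>. The eigenvalues \<open>q ^ j\<close> of \<open>y\<close> are distinct. By interpolation
  the elements \<open>x * f(y)\<close> therefore act on \<open>1, t, \<dots>, t ^ (d - 1)\<close> as shifts with arbitrary
  coefficients, which suffices to separate one word of length \<open>d\<close> from all other words of length
  at most \<open>d\<close> (\<open>detect_word\<close>), and hence to refute a monic identity of degree \<open>d\<close>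
  (\<open>monic_not_identity\<close>).
\<close>

section \<open>Evaluation modulo a two-sided ideal\<close>

definition linear_extension ::
  "('w \<Rightarrow> 'c::comm_monoid_add \<Rightarrow> 'a::comm_monoid_add) \<Rightarrow> ('w \<Rightarrow>\<^sub>0 'c) \<Rightarrow> 'a"
  where "linear_extension \<phi> f = (\<Sum>w\<in>Poly_Mapping.keys f. \<phi> w (Poly_Mapping.lookup f w))"

lemma linear_extension_single:
  assumes "\<And>w. \<phi> w 0 = 0"
  shows "linear_extension \<phi> (Poly_Mapping.single v c) = \<phi> v c"
  using assms by (cases "c = 0") (auto simp: linear_extension_def)

lemma linear_extension_add:
  assumes "\<And>w. \<phi> w 0 = 0" "\<And>w c d. \<phi> w (c + d) = \<phi> w c + \<phi> w d"
  shows "linear_extension \<phi> (f + g) = linear_extension \<phi> f + linear_extension \<phi> g"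
  unfolding linear_extension_def
  by (rule setsum_keys_plus_distrib) (use assms in auto)

lemma linear_extension_sum:
  assumes "\<And>w. \<phi> w 0 = 0" "\<And>w c d. \<phi> w (c + d) = \<phi> w c + \<phi> w d"
  shows "linear_extension \<phi> (\<Sum>i\<in>S. f i) = (\<Sum>i\<in>S. linear_extension \<phi> (f i))"
  by (induction S rule: infinite_finite_induct)
     (simp_all add: linear_extension_add assms, simp_all add: linear_extension_def)

lemma poly_mapping_induct_single [case_names single add]:
  assumes "\<And>w c. P (Poly_Mapping.single w c)" "\<And>f g. P f \<Longrightarrow> P g \<Longrightarrow> P (f + g)"
  shows "P (f :: 'w \<Rightarrow>\<^sub>0 'c::comm_monoid_add)"
proof (induction f rule: update_induct)
  case const
  show ?case using assms(1)[of undefined 0] by simp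
next
  case (update f k v)
  have "Poly_Mapping.update k v f = f + Poly_Mapping.single k v"
    using update(1) by (intro poly_mapping_eqI)
      (auto simp: lookup_add lookup_update lookup_single when_def in_keys_iff)
  thus ?case using assms update by simp
qed

text \<open>
  The counterpart of \<^const>\<open>nc_eval\<close> for rings given by a type class, where the arithmetic
  needs no carrier side conditions. Identities of a quotient ring are studied as memberships of
  such values in the ideal.
\<close>

definition type_eval :: "('x \<Rightarrow> 'a::ring_1) \<Rightarrow> ('x, int) free_algebra \<Rightarrow> 'a"
  where "type_eval A = linear_extension (\<lambda>w c. of_int c * prod_list (map A (letters w)))"

lemma ring_of_type_algebra_simps [simp]:
  fixes x y :: "'a :: ring_1"
  shows "carrier (ring_of_type_algebra :: 'a ring) = UNIV"
    and "x \<otimes>\<^bsub>ring_of_type_algebra\<^esub> y = x * y"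
    and "x \<oplus>\<^bsub>ring_of_type_algebra\<^esub> y = x + y"
    and "\<one>\<^bsub>ring_of_type_algebra\<^esub> = (1::'a)"
    and "\<zero>\<^bsub>ring_of_type_algebra\<^esub> = (0::'a)"
  by (simp_all add: ring_of_type_algebra_def)

locale two_sided_ideal =
  fixes I :: "'a :: ring_1 set"
  assumes ideal: "ideal I ring_of_type_algebra"
begin

abbreviation quotient_ring :: "'a set ring"
  where "quotient_ring \<equiv> ring_of_type_algebra Quot I"

sublocale R: ideal I "ring_of_type_algebra :: 'a ring"
  by (rule ideal)

lemma ring_of_type_algebra_uminus [simp]: "\<ominus>\<^bsub>ring_of_type_algebra\<^esub> (x::'a) = - x"
  by (rule R.minus_equality) simp_all

lemma zero_mem: "0 \<in> I"
  using additive_subgroup.zero_closed[OF R.additive_subgroup_axioms] by simp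

lemma add_mem: "x \<in> I \<Longrightarrow> y \<in> I \<Longrightarrow> x + y \<in> I"
  using additive_subgroup.a_closed[OF R.additive_subgroup_axioms] by simp

lemma mult_left_mem: "x \<in> I \<Longrightarrow> y * x \<in> I"
  using R.I_l_closed by simp

lemma mult_right_mem: "x \<in> I \<Longrightarrow> x * y \<in> I"
  using R.I_r_closed by simp

lemma uminus_mem: "x \<in> I \<Longrightarrow> - x \<in> I"
  using mult_left_mem[of x "- 1"] by simp

lemma diff_mem: "x \<in> I \<Longrightarrow> y \<in> I \<Longrightarrow> x - y \<in> I"
  using add_mem[of x "- y"] uminus_mem by simp

lemma sum_mem: "(\<And>i. i \<in> S \<Longrightarrow> f i \<in> I) \<Longrightarrow> sum f S \<in> I"
  by (induction S rule: infinite_finite_induct) (auto simp: zero_mem add_mem)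

abbreviation coset :: "'a \<Rightarrow> 'a set"
  where "coset x \<equiv> I +>\<^bsub>ring_of_type_algebra\<^esub> x"

sublocale Q: ring quotient_ring
  by (rule R.quotient_is_ring)

lemma coset_closed [simp]: "coset x \<in> carrier quotient_ring"
  using ring_hom_closed[OF R.rcos_ring_hom] by simp

lemma coset_mult: "coset x \<otimes>\<^bsub>quotient_ring\<^esub> coset y = coset (x * y)"
  using ring_hom_mult[OF R.rcos_ring_hom, of x y] by simp

lemma coset_add: "coset x \<oplus>\<^bsub>quotient_ring\<^esub> coset y = coset (x + y)"
  using ring_hom_add[OF R.rcos_ring_hom, of x y] by simp

lemma coset_one: "\<one>\<^bsub>quotient_ring\<^esub> = coset 1"
  using ring_hom_one[OF R.rcos_ring_hom] by simp

lemma coset_eq_zero_iff: "coset x = \<zero>\<^bsub>quotient_ring\<^esub> \<longleftrightarrow> x \<in> I"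
  using R.a_coset_join1[of I x] R.a_coset_join2[of x I] R.a_subgroup
  by (auto simp: FactRing_def)

lemma coset_zero: "\<zero>\<^bsub>quotient_ring\<^esub> = coset 0"
  using coset_eq_zero_iff[of 0] zero_mem by simp

lemma coset_uminus: "\<ominus>\<^bsub>quotient_ring\<^esub> coset x = coset (- x)"
  by (rule Q.minus_equality) (simp_all add: coset_add coset_zero)

lemma coset_surj: "a \<in> carrier quotient_ring \<Longrightarrow> \<exists>x. a = coset x"
  by (auto simp: FactRing_def A_RCOSETS_def')

lemma coset_nat_mult: "[n] \<cdot>\<^bsub>quotient_ring\<^esub> coset x = coset (of_nat n * x)" for n :: nat
  by (induction n) (simp_all add: coset_zero coset_add algebra_simps)

lemma coset_int_mult: "[n] \<cdot>\<^bsub>quotient_ring\<^esub> coset x = coset (of_int n * x)" for n :: int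
proof (cases "n \<ge> 0")
  case True
  thus ?thesis by (simp add: add_pow_int_ge coset_nat_mult)
next
  case False
  thus ?thesis by (simp add: add_pow_int_lt coset_nat_mult coset_uminus)
qed

lemma coset_sum:
  assumes "finite S"
  shows "(\<Oplus>\<^bsub>quotient_ring\<^esub> i\<in>S. coset (f i)) = coset (sum f S)"
  using assms by (induction S) (simp_all add: coset_zero coset_add)

lemma coset_word_eval:
  assumes "\<And>x. x \<in> set (letters w) \<Longrightarrow> a x = coset (A x)"
  shows "word_eval quotient_ring a w = coset (prod_list (map A (letters w)))"
proof -
  have "foldr (\<otimes>\<^bsub>quotient_ring\<^esub>) (map a ws) \<one>\<^bsub>quotient_ring\<^esub> = coset (prod_list (map A ws))"
    if "\<And>x. x \<in> set ws \<Longrightarrow> a x = coset (A x)" for ws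
    using that by (induction ws) (simp_all add: coset_one coset_mult)
  thus ?thesis using assms by (simp add: word_eval_def)
qed

lemma coset_nc_eval:
  assumes "\<And>w x. w \<in> Poly_Mapping.keys g \<Longrightarrow> x \<in> set (letters w) \<Longrightarrow> a x = coset (A x)"
  shows "nc_eval quotient_ring a g = coset (type_eval A g)"
proof -
  have "nc_eval quotient_ring a g =
      (\<Oplus>\<^bsub>quotient_ring\<^esub> w\<in>Poly_Mapping.keys g.
        coset (of_int (Poly_Mapping.lookup g w) * prod_list (map A (letters w))))"
    unfolding nc_eval_def
    by (rule Q.finsum_cong')
       (use assms in \<open>simp_all add: coset_word_eval coset_int_mult Pi_def\<close>)
  thus ?thesis
    by (simp add: coset_sum type_eval_def linear_extension_def)
qed

text \<open>
  Elements of the quotient are cosets of ring elements, and evaluation commutes with passing to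
  cosets. So an identity of the quotient is a polynomial all of whose values upstairs lie in \<open>I\<close>.
\<close>

lemma PI_ring_quotient_iff:
  "PI_ring quotient_ring \<longleftrightarrow>
    (\<exists>(m::nat) g. (\<forall>w \<in> Poly_Mapping.keys g. set (letters w) \<subseteq> {1..m}) \<and> nc_monic g \<and>
      (\<forall>A. type_eval A g \<in> I))"
proof -
  have "(\<forall>a. (\<forall>i \<in> {1..m}. a i \<in> carrier quotient_ring) \<longrightarrow> nc_eval quotient_ring a g = \<zero>\<^bsub>quotient_ring\<^esub>)
      \<longleftrightarrow> (\<forall>A. type_eval A g \<in> I)" (is "?L \<longleftrightarrow> ?R")
    if g: "\<forall>w \<in> Poly_Mapping.keys g. set (letters w) \<subseteq> {1..m}" for m :: nat and g
  proof
    assume L: ?L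
    show ?R
    proof
      fix A
      have "nc_eval quotient_ring (\<lambda>i. coset (A i)) g = coset (type_eval A g)"
        by (rule coset_nc_eval) simp
      moreover have "nc_eval quotient_ring (\<lambda>i. coset (A i)) g = \<zero>\<^bsub>quotient_ring\<^esub>"
        using L[rule_format, of "\<lambda>i. coset (A i)"] coset_closed by blast
      ultimately have "coset (type_eval A g) = \<zero>\<^bsub>quotient_ring\<^esub>" by (rule subst)
      thus "type_eval A g \<in> I" by (rule iffD1[OF coset_eq_zero_iff])
    qed
  next
    assume R: ?R
    show ?L
    proof (intro allI impI)
      fix a assume "\<forall>i \<in> {1..m}. a i \<in> carrier quotient_ring"
      hence "\<forall>i \<in> {1..m}. \<exists>x. a i = coset x"
        using coset_surj by blast
      then obtain A where "\<forall>i \<in> {1..m}. a i = coset (A i)"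
        unfolding bchoice_iff by blast
      hence "nc_eval quotient_ring a g = coset (type_eval A g)"
        using g by (intro coset_nc_eval) blast
      thus "nc_eval quotient_ring a g = \<zero>\<^bsub>quotient_ring\<^esub>"
        using R by (simp add: coset_eq_zero_iff)
    qed
  qed
  thus ?thesis unfolding PI_ring_def using Q.ring_axioms by blast
qed

end

section \<open>The standard identity\<close>

(* The list of variables [1..<Suc N] is to be treated as a whole. *)
declare upt_Suc [simp del]

lemma type_eval_single: "type_eval A (Poly_Mapping.single w c) = of_int c * prod_list (map A (letters w))"
  unfolding type_eval_def by (rule linear_extension_single) simp

lemma type_eval_sum: "type_eval A (sum f S) = (\<Sum>i\<in>S. type_eval A (f i))"
  unfolding type_eval_def by (rule linear_extension_sum) (simp_all add: ring_distribs)

definition standard_polynomial :: "nat \<Rightarrow> (nat, int) free_algebra"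
  where "standard_polynomial N =
    (\<Sum>p | p permutes {1..N}. Poly_Mapping.single (Word (map p [1..<Suc N])) (sign p))"

lemma lookup_standard_polynomial:
  "Poly_Mapping.lookup (standard_polynomial N) w =
    (\<Sum>p | p permutes {1..N}. if Word (map p [1..<Suc N]) = w then sign p else 0)"
  by (simp add: standard_polynomial_def lookup_sum lookup_single when_def)

lemma keys_standard_polynomial:
  assumes "w \<in> Poly_Mapping.keys (standard_polynomial N)"
  shows "\<exists>p. p permutes {1..N} \<and> w = Word (map p [1..<Suc N])"
proof (rule ccontr)
  assume "\<nexists>p. p permutes {1..N} \<and> w = Word (map p [1..<Suc N])"
  hence "Poly_Mapping.lookup (standard_polynomial N) w = 0"
    unfolding lookup_standard_polynomial by (intro sum.neutral) auto
  thus False using assms by (simp add: in_keys_iff)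
qed

lemma letters_standard_polynomial:
  assumes "w \<in> Poly_Mapping.keys (standard_polynomial N)"
  shows "set (letters w) \<subseteq> {1..N}"
proof -
  obtain p where p: "p permutes {1..N}" "w = Word (map p [1..<Suc N])"
    using keys_standard_polynomial[OF assms] by blast
  hence "p ` {1..N} = {1..N}" by (simp add: permutes_image)
  thus ?thesis using p(2) by (simp add: atLeastLessThanSuc_atLeastAtMost)
qed

lemma nc_monic_standard_polynomial: "nc_monic (standard_polynomial N)"
proof -
  let ?w = "Word (map id [1..<Suc N])"
  have "p = id" if "p permutes {1..N}" "map p [1..<Suc N] = [1..<Suc N]" for p
  proof
    fix x
    have "p x = x" if "x \<in> {1..N}"
      using that \<open>map p _ = _\<close> map_eq_conv[of p "[1..<Suc N]" id] by auto
    thus "p x = id x" using \<open>p permutes _\<close> by (cases "x \<in> {1..N}") (auto simp: permutes_def)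
  qed
  hence "Word (map p [1..<Suc N]) = ?w \<longleftrightarrow> p = id" if "p permutes {1..N}" for p
    using that by auto
  hence "Poly_Mapping.lookup (standard_polynomial N) ?w =
      (\<Sum>p | p permutes {1..N}. if p = id then sign p else 0)"
    unfolding lookup_standard_polynomial by (intro sum.cong) auto
  also have "\<dots> = 1"
    by (simp add: finite_permutations permutes_id)
  finally have lookup: "Poly_Mapping.lookup (standard_polynomial N) ?w = 1" .
  have "length (letters v) = N" if "v \<in> Poly_Mapping.keys (standard_polynomial N)" for v
    using keys_standard_polynomial[OF that] by (elim exE conjE) simp
  thus ?thesis
    unfolding nc_monic_def using lookup by (intro bexI[of _ ?w]) (auto simp: in_keys_iff)
qed

lemma type_eval_standard_polynomial:
  "type_eval A (standard_polynomial N) =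
    (\<Sum>p | p permutes {1..N}. of_int (sign p) * prod_list (map A (map p [1..<Suc N])))"
  by (simp add: standard_polynomial_def type_eval_sum type_eval_single)

text \<open>
  Composing with the transposition of \<open>i\<close> and \<open>j\<close> pairs the even with the odd permutations. Paired
  terms have the same product, because \<open>A i = A j\<close>, and opposite signs. The pairing argument gives
  \<open>0\<close> itself and not only \<open>s = - s\<close>, which would be empty in characteristic two.
\<close>

lemma standard_polynomial_alternating:
  fixes A :: "nat \<Rightarrow> 'a::ring_1"
  assumes ij: "i \<in> {1..N}" "j \<in> {1..N}" "i \<noteq> j" and eq: "A i = A j"
  shows "type_eval A (standard_polynomial N) = 0"
proof -
  let ?\<tau> = "transpose i j"
  let ?T = "\<lambda>p. of_int (sign p) * prod_list (map A (map p [1..<Suc N]))"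
  let ?P = "{p. p permutes {1..N}}"
  let ?E = "{p \<in> ?P. evenperm p}" and ?O = "{p \<in> ?P. \<not> evenperm p}"
  have \<tau>: "?\<tau> permutes {1..N}" using ij by (intro permutes_swap_id)
  have perm: "permutation p" if "p permutes {1..N}" for p
    using that permutation_permutes by blast
  have even: "evenperm (?\<tau> \<circ> p) \<longleftrightarrow> \<not> evenperm p" if "p permutes {1..N}" for p
    using evenperm_comp[OF perm[OF \<tau>] perm[OF that]] ij by (simp add: evenperm_swap)
  have T: "?T (?\<tau> \<circ> p) = - ?T p" if "p permutes {1..N}" for p
  proof -
    have "sign (?\<tau> \<circ> p) = - sign p"
      using sign_compose[OF perm[OF \<tau>] perm[OF that]] ij by (simp add: sign_swap_id)
    moreover have "A (?\<tau> x) = A x" for x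
      using eq by (simp add: transpose_def)
    hence "map A (map (?\<tau> \<circ> p) [1..<Suc N]) = map A (map p [1..<Suc N])" by simp
    ultimately show ?thesis by (simp only: of_int_minus mult_minus_left)
  qed
  have "sum ?T ?O = (\<Sum>p\<in>?E. ?T (?\<tau> \<circ> p))"
    by (rule sum.reindex_bij_witness[of _ "\<lambda>p. ?\<tau> \<circ> p" "\<lambda>p. ?\<tau> \<circ> p"])
       (use \<tau> in \<open>auto simp: even permutes_compose comp_assoc[symmetric]\<close>)
  also have "\<dots> = (\<Sum>p\<in>?E. - ?T p)"
    by (rule sum.cong[OF refl]) (rule T, simp)
  finally have "sum ?T ?E + sum ?T ?O = 0" by (simp add: sum_negf)
  moreover have "sum ?T ?P = sum ?T ?E + sum ?T ?O"
  proof -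
    have "?P = ?E \<union> ?O" by blast
    hence "sum ?T ?P = sum ?T (?E \<union> ?O)" by (rule arg_cong)
    also have "\<dots> = sum ?T ?E + sum ?T ?O"
      by (rule sum.union_disjoint) (simp_all add: finite_permutations disjoint_iff)
    finally show ?thesis .
  qed
  ultimately show ?thesis by (simp add: type_eval_standard_polynomial)
qed

context two_sided_ideal
begin

definition central_mod :: "'a \<Rightarrow> bool"
  where "central_mod z \<longleftrightarrow> (\<forall>x. z * x - x * z \<in> I)"

lemma prod_list_update_add:
  assumes "distinct ws" "i \<in> set ws"
  shows "prod_list (map (A(i := x + y)) ws) =
    prod_list (map (A(i := x)) ws) + prod_list (map (A(i := (y::'a))) ws)"
  using assms
proof (induction ws)
  case (Cons w ws)
  show ?case
  proof (cases "w = i")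
    case True
    hence "map (A(i := u)) ws = map A ws" for u
      using Cons.prems by auto
    hence rest: "prod_list (map (A(i := u)) ws) = prod_list (map A ws)" for u
      by (rule arg_cong)
    show ?thesis using True by (simp add: rest distrib_right del: fun_upd_apply add: fun_upd_same)
  next
    case False
    thus ?thesis using Cons.IH Cons.prems
      by (simp add: distrib_left del: fun_upd_apply add: fun_upd_other)
  qed
qed simp

text \<open>
  A central factor in one variable can be pulled out of every word in which this variable occurs
  exactly once.
\<close>

lemma prod_list_update_central:
  assumes "distinct ws" "i \<in> set ws" "central_mod z"
  shows "prod_list (map (A(i := z * x)) ws) - z * prod_list (map (A(i := x)) ws) \<in> I"
  using assms(1,2)
proof (induction ws)
  case (Cons w ws)
  show ?case
  proof (cases "w = i")
    case True
    hence "map (A(i := u)) ws = map A ws" for u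
      using Cons.prems by auto
    hence rest: "prod_list (map (A(i := u)) ws) = prod_list (map A ws)" for u
      by (rule arg_cong)
    show ?thesis using True zero_mem by (simp add: rest mult.assoc del: fun_upd_apply add: fun_upd_same)
  next
    case False
    let ?p = "prod_list (map (A(i := z * x)) ws)" and ?q = "prod_list (map (A(i := x)) ws)"
    have "?p - z * ?q \<in> I" using Cons.IH Cons.prems False by (simp del: fun_upd_apply)
    moreover have "z * A w - A w * z \<in> I" using assms(3) by (simp add: central_mod_def)
    ultimately have "A w * (?p - z * ?q) - (z * A w - A w * z) * ?q \<in> I"
      by (rule diff_mem[OF mult_left_mem mult_right_mem])
    thus ?thesis using False by (simp add: algebra_simps del: fun_upd_apply add: fun_upd_other)
  qed
qed simp

lemma prod_list_update_ideal:
  assumes "i \<in> set ws" "x \<in> I"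
  shows "prod_list (map (A(i := x)) ws) \<in> I"
  using assms
  by (induction ws) (auto simp: mult_left_mem mult_right_mem)

text \<open>
  In the quotient these elements become the sums of products \<open>z\<^sub>1 * \<dots> * z\<^sub>k * b\<close> with all \<open>z\<^sub>i\<close> in \<open>Z\<close>
  and \<open>b\<close> in \<open>B\<close>. If the elements of \<open>Z\<close> are central, these sums lie in the module that \<open>B\<close>
  generates over the centre.
\<close>

inductive_set central_span :: "'a set \<Rightarrow> 'a set \<Rightarrow> 'a set" for Z B :: "'a set"
  where
    generator: "x \<in> B \<Longrightarrow> x \<in> central_span Z B"
  | ideal: "x \<in> I \<Longrightarrow> x \<in> central_span Z B"
  | add: "x \<in> central_span Z B \<Longrightarrow> y \<in> central_span Z B \<Longrightarrow> x + y \<in> central_span Z B"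
  | mult: "z \<in> Z \<Longrightarrow> x \<in> central_span Z B \<Longrightarrow> z * x \<in> central_span Z B"

text \<open>
  The standard polynomial is linear in each variable over the centre, because each of its words
  contains each variable exactly once. Hence vanishing for values of one variable in \<open>B\<close> extends to
  the whole span of \<open>B\<close>.
\<close>

lemma standard_polynomial_span_step:
  assumes Z: "\<And>z. z \<in> Z \<Longrightarrow> central_mod z" and i: "i \<in> {1..N}"
    and B: "\<And>b. b \<in> B \<Longrightarrow> type_eval (A(i := b)) (standard_polynomial N) \<in> I"
    and x: "x \<in> central_span Z B"
  shows "type_eval (A(i := x)) (standard_polynomial N) \<in> I"
  using x
proof induction
  have ws: "distinct (map p [1..<Suc N])" "i \<in> set (map p [1..<Suc N])"
    if "p permutes {1..N}" for p
  proof -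
    show "distinct (map p [1..<Suc N])"
      using permutes_inj[OF that] by (simp add: distinct_map inj_on_subset[of p UNIV])
    have "p ` {1..N} = {1..N}" using that by (rule permutes_image)
    thus "i \<in> set (map p [1..<Suc N])" using i by (simp add: atLeastLessThanSuc_atLeastAtMost)
  qed
  {
    case (generator x)
    thus ?case by (rule B)
  next
    case (ideal x)
    thus ?case unfolding type_eval_standard_polynomial
      by (intro sum_mem mult_left_mem prod_list_update_ideal ws) auto
  next
    case (add x y)
    have "type_eval (A(i := x + y)) (standard_polynomial N) =
        type_eval (A(i := x)) (standard_polynomial N) + type_eval (A(i := y)) (standard_polynomial N)"
      unfolding type_eval_standard_polynomial sum.distrib[symmetric] distrib_left[symmetric]
      by (intro sum.cong refl arg_cong2[where f = "(*)"] prod_list_update_add ws) auto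
    thus ?case using add_mem[OF add.IH] by (simp only:)
  next
    case (mult z x)
    have "type_eval (A(i := z * x)) (standard_polynomial N) - z * type_eval (A(i := x)) (standard_polynomial N) =
      (\<Sum>p | p permutes {1..N}. of_int (sign p) * 
        (prod_list (map (A(i := z * x)) (map p [1..<Suc N])) - z * prod_list (map (A(i := x)) (map p [1..<Suc N]))))"
      unfolding type_eval_standard_polynomial sum_distrib_left sum_subtractf[symmetric]
      by (intro sum.cong refl) (simp only: right_diff_distrib mult.assoc[symmetric] mult_of_int_commute[of _ z])
    also have "\<dots> \<in> I"
      by (intro sum_mem mult_left_mem prod_list_update_central ws Z) (use mult in auto)
    finally have "type_eval (A(i := z * x)) (standard_polynomial N) - z * type_eval (A(i := x)) (standard_polynomial N) \<in> I" .
    from add_mem[OF this mult_left_mem[OF mult.IH, of z]] show ?case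
      by (simp only: diff_add_cancel)
  }
qed

text \<open>
  A ring that is generated as a module over a central subring by \<open>r\<close> elements satisfies the standard
  identity of degree \<open>r + 1\<close>: by multilinearity only generators have to be substituted, two of the
  \<open>r + 1\<close> values then coincide, and the polynomial is alternating.
\<close>

theorem PI_ring_quotient_if_finite_over_center:
  assumes Z: "\<And>z. z \<in> Z \<Longrightarrow> central_mod z" and B: "finite B"
    and span: "central_span Z B = UNIV"
  shows "PI_ring quotient_ring"
proof -
  define N where "N = Suc (card B)"
  \<comment> \<open>Induction on the number of leading variables that are allowed to leave the generating set.\<close>
  have mem: "type_eval A (standard_polynomial N) \<in> I"
    if "k \<le> N" "\<And>i. i \<in> {1..N} \<Longrightarrow> i > k \<Longrightarrow> A i \<in> B" for k A
    using that
  proof (induction k arbitrary: A)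
    case 0
    have "A ` {1..N} \<subseteq> B" using 0 by auto
    hence "card (A ` {1..N}) \<le> card B" using B by (rule card_mono[rotated])
    hence "\<not> inj_on A {1..N}" using card_image[of A "{1..N}"] by (auto simp: N_def)
    then obtain i j where "i \<in> {1..N}" "j \<in> {1..N}" "i \<noteq> j" "A i = A j"
      unfolding inj_on_def by blast
    thus ?case using standard_polynomial_alternating[of i N j A] zero_mem by simp
  next
    case (Suc k)
    have "type_eval (A(Suc k := A (Suc k))) (standard_polynomial N) \<in> I"
    proof (rule standard_polynomial_span_step[where Z = Z and B = B])
      show "type_eval (A(Suc k := b)) (standard_polynomial N) \<in> I" if "b \<in> B" for b
        using that Suc.prems(1) by (intro Suc.IH) (simp_all add: Suc.prems(2))
    qed (use Suc.prems(1) Z span in simp_all)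
    thus ?case by simp
  qed
  have "type_eval A (standard_polynomial N) \<in> I" for A
    by (rule mem[of N]) auto
  thus ?thesis
    unfolding PI_ring_quotient_iff
    by (intro exI[of _ N] exI[of _ "standard_polynomial N"] conjI ballI allI
          letters_standard_polynomial nc_monic_standard_polynomial)
qed

end

section \<open>Computing in a free algebra modulo an ideal\<close>

lemma scalar_add: "scalar (a + b) = scalar a + scalar (b :: 'k::comm_ring_1)"
  by (simp add: scalar_def single_add)

lemma scalar_mult: "scalar a * scalar b = scalar (a * b :: 'k::comm_ring_1)"
  by (simp add: scalar_def mult_single)

lemma scalar_mult_left: "scalar a * (scalar b * x) = scalar (a * b :: 'k::comm_ring_1) * x"
  by (simp add: mult.assoc[symmetric] scalar_mult)

lemma scalar_zero [simp]: "scalar 0 = 0"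
  by (simp add: scalar_def)

lemma scalar_one [simp]: "scalar (1 :: 'k::comm_ring_1) = 1"
  by (simp add: scalar_def)

lemma scalar_commute: "x * scalar c = scalar c * (x :: ('x, 'k::comm_ring_1) free_algebra)"
proof (induction x rule: poly_mapping_induct_single)
  case (single w d)
  show ?case by (simp add: scalar_def mult_single mult.commute)
qed (simp add: ring_distribs)

lemma scalar_left_commute:
  "x * (scalar c * y) = scalar c * (x * y :: ('x, 'k::comm_ring_1) free_algebra)"
  by (simp add: mult.assoc[symmetric] scalar_commute)

lemma single_eq_scalar_mult_letters:
  "Poly_Mapping.single w c = scalar (c :: 'k::comm_ring_1) * prod_list (map letter (letters w))"
proof -
  have "prod_list (map letter ws) = Poly_Mapping.single (Word ws) (1::'k)" for ws :: "'a list"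
    by (induction ws)
       (simp_all add: zero_free_monoid_def[symmetric] letter_def mult_single plus_free_monoid_def)
  thus ?thesis by (cases w) (simp add: scalar_def mult_single)
qed

lemma free_algebra_induct [case_names scalar letter add]:
  fixes f :: "('x, 'k::comm_ring_1) free_algebra"
  assumes scalar: "\<And>c. P (scalar c)" and letter: "\<And>x f. P f \<Longrightarrow> P (letter x * f)"
    and add: "\<And>f g. P f \<Longrightarrow> P g \<Longrightarrow> P (f + g)"
  shows "P f"
proof (induction f rule: poly_mapping_induct_single)
  case (single w c)
  have "P (scalar c * prod_list (map letter ws))" for ws
  proof (induction ws)
    case (Cons x ws)
    from letter[OF this, of x] show ?case by (simp add: scalar_left_commute)
  qed (simp add: scalar)
  thus ?case by (simp add: single_eq_scalar_mult_letters)
qed (rule add)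

context two_sided_ideal
begin

definition congruent :: "'a \<Rightarrow> 'a \<Rightarrow> bool" (infix \<open>\<doteq>\<close> 50)
  where "x \<doteq> y \<longleftrightarrow> x - y \<in> I"

lemma congruent_refl [simp]: "x \<doteq> x"
  by (simp add: congruent_def zero_mem)

lemma congruent_sym: "x \<doteq> y \<Longrightarrow> y \<doteq> x"
  using uminus_mem[of "x - y"] by (simp add: congruent_def)

lemma congruent_trans [trans]: "x \<doteq> y \<Longrightarrow> y \<doteq> z \<Longrightarrow> x \<doteq> z"
  using add_mem[of "x - y" "y - z"] by (simp add: congruent_def)

lemma congruent_add: "x \<doteq> y \<Longrightarrow> u \<doteq> v \<Longrightarrow> x + u \<doteq> y + v"
  using add_mem[of "x - y" "u - v"] by (simp add: congruent_def algebra_simps)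

lemma congruent_mult_left: "x \<doteq> y \<Longrightarrow> u * x \<doteq> u * y"
  using mult_left_mem[of "x - y" u] by (simp add: congruent_def right_diff_distrib)

lemma congruent_mult_right: "x \<doteq> y \<Longrightarrow> x * u \<doteq> y * u"
  using mult_right_mem[of "x - y" u] by (simp add: congruent_def left_diff_distrib)

lemma central_mod_iff: "central_mod z \<longleftrightarrow> (\<forall>x. z * x \<doteq> x * z)"
  by (simp add: central_mod_def congruent_def)

lemma central_span_congruent:
  assumes "x \<doteq> y" "y \<in> central_span Z B"
  shows "x \<in> central_span Z B"
  using central_span.add[OF assms(2) central_span.ideal[of "x - y"]] assms(1)
  by (simp add: congruent_def)

end

locale free_algebra_ideal = two_sided_ideal I
  for I :: "('x, 'k::field) free_algebra set"
begin

lemma q_commute_power_right: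
  assumes "y * x \<doteq> scalar q * (x * y)"
  shows "y * x ^ m \<doteq> scalar (q ^ m) * (x ^ m * y)"
proof (induction m)
  case (Suc m)
  have "y * x ^ Suc m = (y * x) * x ^ m" by (simp add: mult.assoc)
  also have "\<dots> \<doteq> (scalar q * (x * y)) * x ^ m"
    using assms by (rule congruent_mult_right)
  also have "\<dots> = (scalar q * x) * (y * x ^ m)" by (simp add: mult.assoc)
  also have "\<dots> \<doteq> (scalar q * x) * (scalar (q ^ m) * (x ^ m * y))"
    using Suc by (rule congruent_mult_left)
  also have "\<dots> = scalar (q ^ Suc m) * (x ^ Suc m * y)"
    by (simp add: mult.assoc scalar_left_commute[of x] scalar_mult_left)
  finally show ?case .
qed simp

lemma q_commute_power_left:
  assumes "y * x \<doteq> scalar q * (x * y)"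
  shows "y ^ m * x \<doteq> scalar (q ^ m) * (x * y ^ m)"
proof (induction m)
  case (Suc m)
  have "y ^ Suc m * x = y * (y ^ m * x)" by (simp add: mult.assoc)
  also have "\<dots> \<doteq> y * (scalar (q ^ m) * (x * y ^ m))"
    using Suc by (rule congruent_mult_left)
  also have "\<dots> = scalar (q ^ m) * ((y * x) * y ^ m)"
    by (simp add: scalar_left_commute[of y] mult.assoc)
  also have "\<dots> \<doteq> scalar (q ^ m) * ((scalar q * (x * y)) * y ^ m)"
    using assms by (intro congruent_mult_left congruent_mult_right)
  also have "\<dots> = scalar (q ^ Suc m) * (x * y ^ Suc m)"
    by (simp add: mult.assoc scalar_mult_left mult.commute[of q])
  finally show ?case .
qed simp

lemma central_mod_scalar: "central_mod (scalar c)"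
  by (simp add: central_mod_iff scalar_commute)

lemma central_mod_if_letters:
  assumes "\<And>x. z * letter x \<doteq> letter x * z"
  shows "central_mod z"
  unfolding central_mod_iff
proof
  fix f
  show "z * f \<doteq> f * z"
  proof (induction f rule: free_algebra_induct)
    case (scalar c)
    show ?case by (simp add: scalar_commute)
  next
    case (letter x f)
    have "z * (letter x * f) = (z * letter x) * f" by (simp add: mult.assoc)
    also have "\<dots> \<doteq> (letter x * z) * f" using assms by (rule congruent_mult_right)
    also have "\<dots> = letter x * (z * f)" by (simp add: mult.assoc)
    also have "\<dots> \<doteq> letter x * (f * z)" using letter by (rule congruent_mult_left)
    finally show ?case by (simp add: mult.assoc)
  next
    case (add f g)
    from congruent_add[OF this] show ?case by (simp add: ring_distribs)
  qed
qed

end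

section \<open>Quantum matrices at roots of unity\<close>

locale quantum_matrix_ideal = free_algebra_ideal I
  for I :: "(generator, 'k::field) free_algebra set" +
  fixes \<alpha> \<beta> :: 'k
  assumes relations: "M2_relations \<alpha> \<beta> \<subseteq> I" and \<alpha>: "\<alpha> \<noteq> 0"
begin

abbreviation "X11 \<equiv> letter G11 :: (generator, 'k) free_algebra"
abbreviation "X12 \<equiv> letter G12 :: (generator, 'k) free_algebra"
abbreviation "X21 \<equiv> letter G21 :: (generator, 'k) free_algebra"
abbreviation "X22 \<equiv> letter G22 :: (generator, 'k) free_algebra"

lemma relation:
  "X12 * X11 \<doteq> scalar \<alpha> * (X11 * X12)"
  "X22 * X21 \<doteq> scalar \<alpha> * (X21 * X22)"
  "X21 * X11 \<doteq> scalar \<beta> * (X11 * X21)"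
  "X22 * X12 \<doteq> scalar \<beta> * (X12 * X22)"
  "X21 * X12 \<doteq> scalar (\<beta> * inverse \<alpha>) * (X12 * X21)"
  using relations by (simp_all add: M2_relations_def Let_def congruent_def mult.assoc)

lemma relation_X22_X11:
  "X22 * X11 \<doteq> X11 * X22 + scalar (\<beta> - inverse \<alpha>) * (X12 * X21)"
  using relations by (simp add: M2_relations_def Let_def congruent_def mult.assoc diff_diff_eq)

lemmas power_right = relation[THEN q_commute_power_right]
lemmas power_left = relation[THEN q_commute_power_left]

lemma X12_X21_X11: "X12 * (X21 * X11) \<doteq> scalar (\<alpha> * \<beta>) * (X11 * (X12 * X21))"
proof -
  have "X12 * (X21 * X11) \<doteq> X12 * (scalar \<beta> * (X11 * X21))"
    by (intro congruent_mult_left relation)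
  also have "\<dots> = scalar \<beta> * ((X12 * X11) * X21)"
    by (simp add: scalar_left_commute[of X12] mult.assoc)
  also have "\<dots> \<doteq> scalar \<beta> * ((scalar \<alpha> * (X11 * X12)) * X21)"
    by (intro congruent_mult_left congruent_mult_right relation)
  also have "\<dots> = scalar (\<alpha> * \<beta>) * (X11 * (X12 * X21))"
    by (simp add: mult.assoc scalar_mult_left mult.commute)
  finally show ?thesis .
qed

lemma X22_X12_X21: "X22 * (X12 * X21) \<doteq> scalar (\<alpha> * \<beta>) * (X12 * (X21 * X22))"
proof -
  have "X22 * (X12 * X21) = (X22 * X12) * X21" by (simp add: mult.assoc)
  also have "\<dots> \<doteq> (scalar \<beta> * (X12 * X22)) * X21"
    by (intro congruent_mult_right relation)
  also have "\<dots> = (scalar \<beta> * X12) * (X22 * X21)" by (simp add: mult.assoc)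
  also have "\<dots> \<doteq> (scalar \<beta> * X12) * (scalar \<alpha> * (X21 * X22))"
    by (intro congruent_mult_left relation)
  also have "\<dots> = scalar (\<alpha> * \<beta>) * (X12 * (X21 * X22))"
    by (simp add: mult.assoc scalar_left_commute[of X12] scalar_mult_left mult.commute)
  finally show ?thesis .
qed

text \<open>
  This is the geometric sum \<open>\<Sum>i<m. (\<beta> - inverse \<alpha>) * (\<alpha> * \<beta>) ^ i\<close>. In the closed form the factor
  \<open>\<beta> - inverse \<alpha> = inverse \<alpha> * (\<alpha> * \<beta> - 1)\<close> has cancelled the denominator, so that the value is
  right also when \<open>\<alpha> * \<beta> = 1\<close>, and it is evidently \<open>0\<close> when \<open>(\<alpha> * \<beta>) ^ m = 1\<close>.
\<close>

definition commutator_coeff :: "nat \<Rightarrow> 'k"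
  where "commutator_coeff m = inverse \<alpha> * ((\<alpha> * \<beta>) ^ m - 1)"

lemma commutator_coeff_1: "commutator_coeff (Suc 0) = \<beta> - inverse \<alpha>"
  using \<alpha> by (simp add: commutator_coeff_def field_simps)

lemma commutator_coeff_Suc:
  "commutator_coeff (Suc m) = (\<beta> - inverse \<alpha>) + \<alpha> * \<beta> * commutator_coeff m"
  using \<alpha> by (simp add: commutator_coeff_def field_simps)

text \<open>
  The elements \<open>X11\<close> and \<open>X22\<close> do not commute up to a scalar. Moving \<open>X22\<close> past \<open>X11\<close> produces a
  multiple of \<open>X12 * X21\<close>, which itself commutes with \<open>X11\<close> up to \<open>\<alpha> * \<beta>\<close>; repeating this sums a
  geometric progression with ratio \<open>\<alpha> * \<beta>\<close>.
\<close>

lemma X22_power_X11: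
  "X22 * X11 ^ Suc a \<doteq> X11 ^ Suc a * X22 + scalar (commutator_coeff (Suc a)) * (X11 ^ a * (X12 * X21))"
proof (induction a)
  case 0
  show ?case using relation_X22_X11 by (simp add: commutator_coeff_1)
next
  case (Suc a)
  let ?c = "commutator_coeff (Suc a)"
  have "X22 * X11 ^ Suc (Suc a) = (X22 * X11 ^ Suc a) * X11"
    by (simp add: power_Suc2 mult.assoc del: power_Suc)
  also have "\<dots> \<doteq> (X11 ^ Suc a * X22 + scalar ?c * (X11 ^ a * (X12 * X21))) * X11"
    using Suc by (rule congruent_mult_right)
  also have "\<dots> = X11 ^ Suc a * (X22 * X11) + (scalar ?c * X11 ^ a) * (X12 * (X21 * X11))"
    by (simp add: ring_distribs mult.assoc del: power_Suc)
  also have "\<dots> \<doteq> X11 ^ Suc a * (X11 * X22 + scalar (\<beta> - inverse \<alpha>) * (X12 * X21)) +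
      (scalar ?c * X11 ^ a) * (scalar (\<alpha> * \<beta>) * (X11 * (X12 * X21)))"
    by (intro congruent_add congruent_mult_left relation_X22_X11 X12_X21_X11)
  also have "\<dots> = X11 ^ Suc (Suc a) * X22 +
      (scalar (\<beta> - inverse \<alpha>) + scalar (\<alpha> * \<beta> * ?c)) * (X11 ^ Suc a * (X12 * X21))"
    by (simp add: ring_distribs mult.assoc scalar_left_commute[of "X11 ^ _"]
          scalar_left_commute[of X11] scalar_mult_left power_Suc2 mult.commute[of ?c] del: power_Suc)
  also have "\<dots> = X11 ^ Suc (Suc a) * X22 +
      scalar (commutator_coeff (Suc (Suc a))) * (X11 ^ Suc a * (X12 * X21))"
    by (simp only: commutator_coeff_Suc[of "Suc a"] scalar_add)
  finally show ?case .
qed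

lemma power_X22_X11:
  "X22 ^ Suc d * X11 \<doteq> X11 * X22 ^ Suc d + scalar (commutator_coeff (Suc d)) * (X12 * (X21 * X22 ^ d))"
proof (induction d)
  case 0
  show ?case using relation_X22_X11 by (simp add: commutator_coeff_1)
next
  case (Suc d)
  let ?c = "commutator_coeff (Suc d)"
  have "X22 ^ Suc (Suc d) * X11 = X22 * (X22 ^ Suc d * X11)"
    by (simp add: mult.assoc)
  also have "\<dots> \<doteq> X22 * (X11 * X22 ^ Suc d + scalar ?c * (X12 * (X21 * X22 ^ d)))"
    using Suc by (rule congruent_mult_left)
  also have "\<dots> = (X22 * X11) * X22 ^ Suc d + scalar ?c * ((X22 * (X12 * X21)) * X22 ^ d)"
    by (simp add: ring_distribs mult.assoc scalar_left_commute[of X22] del: power_Suc)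
  also have "\<dots> \<doteq> (X11 * X22 + scalar (\<beta> - inverse \<alpha>) * (X12 * X21)) * X22 ^ Suc d +
      scalar ?c * ((scalar (\<alpha> * \<beta>) * (X12 * (X21 * X22))) * X22 ^ d)"
    by (intro congruent_add congruent_mult_left congruent_mult_right relation_X22_X11 X22_X12_X21)
  also have "\<dots> = X11 * X22 ^ Suc (Suc d) +
      (scalar (\<beta> - inverse \<alpha>) + scalar (\<alpha> * \<beta> * ?c)) * (X12 * (X21 * X22 ^ Suc d))"
    by (simp add: ring_distribs mult.assoc scalar_mult_left mult.commute[of ?c])
  also have "\<dots> = X11 * X22 ^ Suc (Suc d) +
      scalar (commutator_coeff (Suc (Suc d))) * (X12 * (X21 * X22 ^ Suc d))"
    by (simp only: commutator_coeff_Suc[of "Suc d"] scalar_add)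
  finally show ?case .
qed

definition monomial :: "nat \<Rightarrow> nat \<Rightarrow> nat \<Rightarrow> nat \<Rightarrow> (generator, 'k) free_algebra"
  where "monomial a b c d = X11 ^ a * (X12 ^ b * (X21 ^ c * X22 ^ d))"

lemma X11_monomial: "X11 * monomial a b c d = monomial (Suc a) b c d"
  by (simp add: monomial_def mult.assoc)

lemma X12_monomial: "X12 * monomial a b c d \<doteq> scalar (\<alpha> ^ a) * monomial a (Suc b) c d"
  using congruent_mult_right[OF power_right(1)[of a], of "X12 ^ b * (X21 ^ c * X22 ^ d)"]
  by (simp add: monomial_def mult.assoc)

lemma X21_monomial_0:
  "X21 * monomial 0 b c d \<doteq> scalar ((\<beta> * inverse \<alpha>) ^ b) * monomial 0 b (Suc c) d"
  using congruent_mult_right[OF power_right(5)[of b], of "X21 ^ c * X22 ^ d"]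
  by (simp add: monomial_def mult.assoc)

lemma X21_monomial:
  "X21 * monomial a b c d \<doteq> scalar (\<beta> ^ a * (\<beta> * inverse \<alpha>) ^ b) * monomial a b (Suc c) d"
proof -
  have "X21 * monomial a b c d = (X21 * X11 ^ a) * monomial 0 b c d"
    by (simp add: monomial_def mult.assoc)
  also have "\<dots> \<doteq> (scalar (\<beta> ^ a) * (X11 ^ a * X21)) * monomial 0 b c d"
    by (intro congruent_mult_right power_right)
  also have "\<dots> = (scalar (\<beta> ^ a) * X11 ^ a) * (X21 * monomial 0 b c d)"
    by (simp add: mult.assoc)
  also have "\<dots> \<doteq> (scalar (\<beta> ^ a) * X11 ^ a) *
      (scalar ((\<beta> * inverse \<alpha>) ^ b) * monomial 0 b (Suc c) d)"
    by (intro congruent_mult_left X21_monomial_0)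
  also have "\<dots> = scalar (\<beta> ^ a * (\<beta> * inverse \<alpha>) ^ b) * monomial a b (Suc c) d"
    by (simp add: mult.assoc monomial_def scalar_left_commute[of "X11 ^ _"] scalar_mult_left)
  finally show ?thesis .
qed

lemma X22_monomial_0:
  "X22 * monomial 0 b c d \<doteq> scalar (\<beta> ^ b * \<alpha> ^ c) * monomial 0 b c (Suc d)"
proof -
  have "X22 * monomial 0 b c d = (X22 * X12 ^ b) * (X21 ^ c * X22 ^ d)"
    by (simp add: monomial_def mult.assoc)
  also have "\<dots> \<doteq> (scalar (\<beta> ^ b) * (X12 ^ b * X22)) * (X21 ^ c * X22 ^ d)"
    by (intro congruent_mult_right power_right)
  also have "\<dots> = (scalar (\<beta> ^ b) * X12 ^ b) * ((X22 * X21 ^ c) * X22 ^ d)"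
    by (simp add: mult.assoc)
  also have "\<dots> \<doteq> (scalar (\<beta> ^ b) * X12 ^ b) * ((scalar (\<alpha> ^ c) * (X21 ^ c * X22)) * X22 ^ d)"
    by (intro congruent_mult_left congruent_mult_right power_right)
  also have "\<dots> = scalar (\<beta> ^ b * \<alpha> ^ c) * monomial 0 b c (Suc d)"
    by (simp add: mult.assoc monomial_def scalar_left_commute[of "X12 ^ _"] scalar_mult_left)
  finally show ?thesis .
qed

lemma X22_monomial_Suc:
  "X22 * monomial (Suc a) b c d \<doteq> scalar (\<beta> ^ b * \<alpha> ^ c) * monomial (Suc a) b c (Suc d) +
    scalar (commutator_coeff (Suc a) * (\<beta> * inverse \<alpha>) ^ b) * monomial a (Suc b) (Suc c) d"
proof -
  let ?k = "commutator_coeff (Suc a)"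
  have "X22 * monomial (Suc a) b c d = (X22 * X11 ^ Suc a) * monomial 0 b c d"
    by (simp add: monomial_def mult.assoc)
  also have "\<dots> \<doteq> (X11 ^ Suc a * X22 + scalar ?k * (X11 ^ a * (X12 * X21))) * monomial 0 b c d"
    by (intro congruent_mult_right X22_power_X11)
  also have "\<dots> = X11 ^ Suc a * (X22 * monomial 0 b c d) +
      (scalar ?k * (X11 ^ a * X12)) * (X21 * monomial 0 b c d)"
    by (simp add: ring_distribs mult.assoc del: power_Suc)
  also have "\<dots> \<doteq> X11 ^ Suc a * (scalar (\<beta> ^ b * \<alpha> ^ c) * monomial 0 b c (Suc d)) +
      (scalar ?k * (X11 ^ a * X12)) * (scalar ((\<beta> * inverse \<alpha>) ^ b) * monomial 0 b (Suc c) d)"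
    by (intro congruent_add congruent_mult_left X22_monomial_0 X21_monomial_0)
  also have "\<dots> = scalar (\<beta> ^ b * \<alpha> ^ c) * monomial (Suc a) b c (Suc d) +
      scalar (?k * (\<beta> * inverse \<alpha>) ^ b) * monomial a (Suc b) (Suc c) d"
    by (simp add: mult.assoc monomial_def scalar_left_commute[of "X11 ^ _"]
          scalar_left_commute[of X11] scalar_left_commute[of X12] scalar_mult_left)
  finally show ?thesis .
qed

context
  fixes n :: nat
  assumes n: "n > 0" and \<alpha>_root: "\<alpha> ^ n = 1" and \<beta>_root: "\<beta> ^ n = 1"
begin

lemma ratio_root: "(\<beta> * inverse \<alpha>) ^ n = 1"
  using \<alpha>_root \<beta>_root by (simp add: power_mult_distrib power_inverse)

lemma commutator_coeff_root: "commutator_coeff n = 0"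
  using \<alpha>_root \<beta>_root by (simp add: commutator_coeff_def power_mult_distrib)

text \<open>
  Passing a generator across an \<open>n\<close>-th power of another one multiplies by an \<open>n\<close>-th power of \<open>\<alpha>\<close>,
  \<open>\<beta>\<close> or \<open>\<beta> * inverse \<alpha>\<close>, or by the inverse of such a power, and these are all \<open>1\<close>. For \<open>X11\<close> and \<open>X22\<close> the extra term has the
  coefficient \<^term>\<open>commutator_coeff n\<close>, which is \<open>0\<close>.
\<close>

lemma central_mod_powers: "central_mod (letter g ^ n)"
proof (rule central_mod_if_letters)
  fix x
  have Suc: "Suc (n - 1) = n" using n by simp
  note 1 = X22_power_X11[of "n - 1", unfolded Suc commutator_coeff_root scalar_zero mult_zero_left add_0_right]
    power_X22_X11[of "n - 1", unfolded Suc commutator_coeff_root scalar_zero mult_zero_left add_0_right]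
  note pr = power_right[of n] and pl = power_left[of n]
  note comm = 1 pr[unfolded \<alpha>_root \<beta>_root ratio_root scalar_one mult_1_left]
    pl[unfolded \<alpha>_root \<beta>_root ratio_root scalar_one mult_1_left]
  show "letter g ^ n * letter x \<doteq> letter x * letter g ^ n"
    by (cases g; cases x)
       (simp_all only: power_commutes congruent_refl comm comm[THEN congruent_sym])
qed

abbreviation "central_elements \<equiv> range scalar \<union> range (\<lambda>g. letter g ^ n)"
definition small_monomials :: "(generator, 'k) free_algebra set"
  where "small_monomials =
    (\<lambda>(a, b, c, d). monomial a b c d) ` ({..<n} \<times> {..<n} \<times> {..<n} \<times> {..<n})"

abbreviation "small_span \<equiv> central_span central_elements small_monomials"

lemma central_elements: "z \<in> central_elements \<Longrightarrow> central_mod z"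
  by (elim UnE rangeE) (simp_all only: central_mod_scalar central_mod_powers)

lemma scalar_span: "x \<in> small_span \<Longrightarrow> scalar c * x \<in> small_span"
  by (rule central_span.mult[OF UnI1[OF rangeI]])

lemma power_span: "x \<in> small_span \<Longrightarrow> letter g ^ n * x \<in> small_span"
  by (rule central_span.mult[OF UnI2[OF rangeI]])

lemma pull_power_span:
  assumes "u * v \<in> small_span"
  shows "u * (letter g ^ n * v) \<in> small_span"
proof (rule central_span_congruent)
  have "(u * letter g ^ n) * v \<doteq> (letter g ^ n * u) * v"
    by (rule congruent_mult_right[OF congruent_sym[OF
          central_mod_powers[unfolded central_mod_iff, rule_format]]])
  thus "u * (letter g ^ n * v) \<doteq> letter g ^ n * (u * v)" by (simp add: mult.assoc)
  show "letter g ^ n * (u * v) \<in> small_span" using assms by (rule power_span)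
qed

text \<open>
  As long as an exponent is at least \<open>n\<close>, a central \<open>n\<close>-th power can be split off.
\<close>

lemma monomial_span: "monomial a b c d \<in> small_span"
proof (induction "a + b + c + d" arbitrary: a b c d rule: less_induct)
  case less
  have split: "x ^ m = x ^ n * x ^ (m - n)" if "m \<ge> n" for x :: "(generator, 'k) free_algebra" and m
    using that power_add[of x n "m - n"] by (simp only: le_add_diff_inverse)
  consider "a \<ge> n" | "b \<ge> n" | "c \<ge> n" | "d \<ge> n" | "a < n" "b < n" "c < n" "d < n"
    by linarith
  thus ?case
  proof cases
    case 1
    have "monomial (a - n) b c d \<in> small_span" by (rule less) (use 1 n in simp)
    from power_span[OF this, of G11] show ?thesis
      by (simp only: monomial_def split[OF 1, of X11] mult.assoc)
  next
    case 2
    have "monomial a (b - n) c d \<in> small_span" by (rule less) (use 2 n in simp)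
    from pull_power_span[OF this[unfolded monomial_def], of G12] show ?thesis
      by (simp only: monomial_def split[OF 2, of X12] mult.assoc)
  next
    case 3
    have "monomial a b (c - n) d \<in> small_span" by (rule less) (use 3 n in simp)
    hence "(X11 ^ a * X12 ^ b) * (X21 ^ (c - n) * X22 ^ d) \<in> small_span"
      by (simp add: monomial_def mult.assoc)
    from pull_power_span[OF this, of G21] show ?thesis
      by (simp only: monomial_def split[OF 3, of X21] mult.assoc)
  next
    case 4
    have "monomial a b c (d - n) \<in> small_span" by (rule less) (use 4 n in simp)
    hence "(X11 ^ a * X12 ^ b * X21 ^ c) * X22 ^ (d - n) \<in> small_span"
      by (simp add: monomial_def mult.assoc)
    from pull_power_span[OF this, of G22] show ?thesis
      by (simp only: monomial_def split[OF 4, of X22] mult.assoc)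
  next
    case 5
    hence "monomial a b c d \<in> small_monomials"
      unfolding small_monomials_def by (intro image_eqI[of _ _ "(a, b, c, d)"]) simp_all
    thus ?thesis by (rule central_span.generator)
  qed
qed

lemma letter_monomial_span: "letter g * monomial a b c d \<in> small_span"
proof (cases g)
  case G11
  thus ?thesis by (simp add: X11_monomial monomial_span)
next
  case G12
  show ?thesis unfolding G12
    by (rule central_span_congruent[OF X12_monomial]) (intro scalar_span monomial_span)
next
  case G21
  show ?thesis unfolding G21
    by (rule central_span_congruent[OF X21_monomial]) (intro scalar_span monomial_span)
next
  case G22
  show ?thesis unfolding G22
  proof (cases a)
    case 0
    show "X22 * monomial a b c d \<in> small_span" unfolding 0
      by (rule central_span_congruent[OF X22_monomial_0]) (intro scalar_span monomial_span)
  next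
    case (Suc a')
    show "X22 * monomial a b c d \<in> small_span" unfolding Suc
      by (rule central_span_congruent[OF X22_monomial_Suc])
         (intro central_span.add scalar_span monomial_span)
  qed
qed

text \<open>
  Left multiplication by a generator takes each ordered monomial to a combination of ordered
  monomials. Since it commutes with the central elements modulo \<open>I\<close>, it preserves the module that
  the small monomials generate.
\<close>

lemma letter_span: "x \<in> small_span \<Longrightarrow> letter g * x \<in> small_span"
proof (induction rule: central_span.induct)
  case (generator x)
  thus ?case using letter_monomial_span by (auto simp: small_monomials_def)
next
  case (ideal x)
  thus ?case by (intro central_span.ideal mult_left_mem)
next
  case (add x y)
  thus ?case by (simp add: distrib_left central_span.add)
next
  case (mult z x)
  have "(letter g * z) * x \<doteq> (z * letter g) * x"
    by (rule congruent_mult_right[OF congruent_sym[OF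
          central_elements[OF mult(1), unfolded central_mod_iff, rule_format]]])
  hence "letter g * (z * x) \<doteq> z * (letter g * x)" by (simp add: mult.assoc)
  thus ?case by (rule central_span_congruent) (intro central_span.mult mult)
qed

lemma span_UNIV: "small_span = UNIV"
proof -
  have "x \<in> small_span" for x
  proof (induction x rule: free_algebra_induct)
    case (scalar c)
    show ?case using scalar_span[OF monomial_span[of 0 0 0 0], of c] by (simp add: monomial_def)
  qed (auto intro: letter_span central_span.add)
  thus ?thesis by blast
qed

theorem PI_ring_roots_of_unity: "PI_ring quotient_ring"
  by (rule PI_ring_quotient_if_finite_over_center[OF central_elements _ span_UNIV])
     (simp_all add: small_monomials_def)

end

end

section \<open>Quantum planes without polynomial identities\<close>

lemma ideal_free_algebraI:
  fixes J :: "('x, 'r::ring_1) free_algebra set"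
  assumes "0 \<in> J" "\<And>f g. f \<in> J \<Longrightarrow> g \<in> J \<Longrightarrow> f + g \<in> J"
    and left: "\<And>f g. g \<in> J \<Longrightarrow> f * g \<in> J" and "\<And>f g. f \<in> J \<Longrightarrow> f * g \<in> J"
  shows "ideal J ring_of_type_algebra"
proof (rule idealI)
  interpret F: ring "ring_of_type_algebra :: ('x, 'r) free_algebra ring"
    by (rule ring_free_algebra)
  show "ring (ring_of_type_algebra :: ('x, 'r) free_algebra ring)"
    by (rule F.ring_axioms)
  have "\<ominus>\<^bsub>ring_of_type_algebra\<^esub> f = - f" for f :: "('x, 'r) free_algebra"
    by (rule F.minus_equality) simp_all
  moreover have "- f \<in> J" if "f \<in> J" for f
    using left[OF that, of "- 1"] by simp
  ultimately show "subgroup J (add_monoid ring_of_type_algebra)"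
    using assms
    by (intro F.add.subgroupI) (auto simp: a_inv_def[symmetric])
qed (use assms in simp_all)

text \<open>
  Assigning a linear operator on \<open>k[t]\<close> to each letter makes \<open>k[t]\<close> a module over the free algebra.
\<close>

locale operator_family =
  fixes T :: "'x \<Rightarrow> 'k::Fields.field poly \<Rightarrow> 'k poly"
  assumes operator_add: "T x (p + q) = T x p + T x q"
    and operator_smult: "T x (smult c p) = smult c (T x p)"
begin

definition action :: "('x, 'k) free_algebra \<Rightarrow> 'k poly \<Rightarrow> 'k poly"
  where "action f p = linear_extension (\<lambda>w c. smult c (foldr T (letters w) p)) f"

lemma action_single: "action (Poly_Mapping.single w c) p = smult c (foldr T (letters w) p)"
  unfolding action_def by (rule linear_extension_single) simp

lemma action_add: "action (f + g) p = action f p + action g p"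
  unfolding action_def by (rule linear_extension_add) (simp_all add: smult_add_left)

lemma action_sum: "action (sum f S) p = (\<Sum>i\<in>S. action (f i) p)"
  unfolding action_def by (rule linear_extension_sum) (simp_all add: smult_add_left)

lemma action_zero [simp]: "action 0 p = 0"
  by (simp add: action_def linear_extension_def)

lemma action_diff: "action (f - g) p = action f p - action g p"
  using action_add[of "f - g" g p] by simp

lemma action_letter: "action (letter x) p = T x p"
  by (simp add: letter_def action_single)

lemma action_scalar: "action (scalar c) p = smult c p"
  by (simp add: scalar_def action_single zero_free_monoid_def)

lemma action_one: "action 1 p = p"
  using action_single[of 0 1 p, unfolded single_one] by (simp add: zero_free_monoid_def)

lemma action_linear: "action f (p + q) = action f p + action f q"
  "action f (smult c p) = smult c (action f p)"
proof -
  have "foldr T ws (p + q) = foldr T ws p + foldr T ws q" for ws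
    by (induction ws) (simp_all add: operator_add)
  thus "action f (p + q) = action f p + action f q"
    by (simp add: action_def linear_extension_def smult_add_right sum.distrib)
  have "foldr T ws (smult c p) = smult c (foldr T ws p)" for ws
    by (induction ws) (simp_all add: operator_smult)
  thus "action f (smult c p) = smult c (action f p)"
    by (induction f rule: poly_mapping_induct_single)
       (simp_all add: action_single action_add smult_add_right mult.commute)
qed

lemma action_zero_right [simp]: "action f 0 = 0"
  using action_linear(2)[of f 0 0] by simp

lemma action_mult: "action (f * g) p = action f (action g p)"
proof (induction f rule: poly_mapping_induct_single)
  case (single u c)
  show ?case
  proof (induction g rule: poly_mapping_induct_single)
    case (single v d)
    have "action (Poly_Mapping.single u c) (smult d q) = smult (c * d) (foldr T (letters u) q)" for q
      by (simp add: action_linear(2) action_single mult.commute)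
    thus ?case by (simp add: mult_single action_single plus_free_monoid_def)
  next
    case (add g h)
    thus ?case by (simp add: distrib_left action_add action_linear)
  qed
qed (simp add: distrib_right action_add)

lemma ideal_annihilator: "ideal {f. \<forall>p. action f p = 0} ring_of_type_algebra"
  by (rule ideal_free_algebraI) (simp_all add: action_add action_mult)

end

lemma inj_power_if_not_root_of_unity:
  fixes q :: "'k::Fields.field"
  assumes "q \<noteq> 0" "\<And>n. n > 0 \<Longrightarrow> q ^ n \<noteq> 1" "q ^ i = q ^ j"
  shows "i = j"
proof -
  have *: "\<not> a < b" if "q ^ a = q ^ b" for a b
  proof
    assume "a < b"
    hence "q ^ b = q ^ a * q ^ (b - a)" by (simp flip: power_add)
    with that assms(1) have "q ^ (b - a) = 1" by simp
    with assms(2)[of "b - a"] \<open>a < b\<close> show False by simp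
  qed
  from *[of i j] *[of j i] assms(3) show ?thesis by simp
qed

text \<open>
  The operators \<open>p(t) \<mapsto> t p(t)\<close> and \<open>p(t) \<mapsto> p(q t)\<close> satisfy \<open>y x = q x y\<close>, the relation of the
  quantum plane. If \<open>q\<close> is not a root of unity, the powers of \<open>t\<close> are eigenvectors of \<open>y\<close> with
  pairwise distinct eigenvalues.
\<close>

locale quantum_plane_action = operator_family T
  for T :: "'x \<Rightarrow> 'k::Fields.field poly \<Rightarrow> 'k poly" +
  fixes q :: 'k and x y :: 'x
  assumes T_x: "T x p = pCons 0 p"
    and T_y: "T y (monom 1 j) = smult (q ^ j) (monom 1 j)"
    and q_nonzero: "q \<noteq> 0" and q_not_root: "n > 0 \<Longrightarrow> q ^ n \<noteq> 1"
begin

definition diagonal :: "nat list \<Rightarrow> ('x, 'k) free_algebra"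
  where "diagonal ms = prod_list (map (\<lambda>m. letter y - scalar (q ^ m)) ms)"

lemma action_diagonal:
  "action (diagonal ms) (monom 1 j) = smult (\<Prod>m\<leftarrow>ms. q ^ j - q ^ m) (monom 1 j)"
  by (induction ms)
     (simp_all add: diagonal_def action_one action_mult action_linear action_diff action_letter
        action_scalar T_y smult_diff_left[symmetric] mult.commute)

text \<open>
  Lagrange interpolation in \<open>y\<close>: as its eigenvalues on \<open>1, t, \<dots>, t ^ (d - 1)\<close> are distinct, a
  polynomial in \<open>y\<close> acts on these vectors as the projection to any one of them.
\<close>

lemma projection_mod_truncation:
  "\<exists>e. \<forall>j<d. action e (monom 1 j) = (if j = i then monom 1 j else 0)"
proof -
  let ?ms = "filter (\<lambda>m. m \<noteq> i) [0..<d]"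
  let ?c = "\<lambda>j. \<Prod>m\<leftarrow>?ms. q ^ j - q ^ m"
  have "q ^ i \<noteq> q ^ m" if "m \<noteq> i" for m
    using inj_power_if_not_root_of_unity[OF q_nonzero q_not_root, of i m] that by blast
  hence "?c i \<noteq> 0"
    by (auto simp: prod_list_zero_iff)
  moreover have "?c j = 0" if "j < d" "j \<noteq> i" for j
    using that by (auto simp: prod_list_zero_iff)
  ultimately show ?thesis
    by (intro exI[of _ "scalar (inverse (?c i)) * diagonal ?ms"])
       (auto simp: action_mult action_scalar action_diagonal)
qed

lemma partial_shift:
  "\<exists>f. \<forall>j<d. action f (monom 1 j) = (if P j then monom 1 (Suc j) else 0)"
proof -
  have "\<forall>i. \<exists>e. \<forall>j<d. action e (monom 1 j) = (if j = i then monom 1 j else 0)"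
    using projection_mod_truncation by blast
  then obtain e where "\<forall>i. \<forall>j<d. action (e i) (monom 1 j) = (if j = i then monom 1 j else 0)"
    unfolding choice_iff by (rule exE)
  hence e: "action (e i) (monom 1 j) = (if j = i then monom 1 j else 0)" if "j < d" for i j
    using that by blast
  have "action (letter x * (\<Sum>i | i < d \<and> P i. e i)) (monom 1 j) = (if P j then monom 1 (Suc j) else 0)"
    if "j < d" for j
  proof -
    have "action (\<Sum>i | i < d \<and> P i. e i) (monom 1 j) =
        (\<Sum>i | i < d \<and> P i. if j = i then monom 1 j else 0)"
      using that by (simp add: action_sum e)
    also have "\<dots> = (if P j then monom 1 j else 0)"
      using that by simp
    finally show ?thesis
      by (simp add: action_mult action_letter T_x monom_Suc)
  qed
  thus ?thesis by blast
qed

text \<open>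
  Let the value of the letter \<open>a\<close> raise \<open>t ^ j\<close> to \<open>t ^ (j + 1)\<close> if \<open>a\<close> is the letter of \<open>ls\<close> that
  has \<open>j\<close> letters to its right, and kill \<open>t ^ j\<close> otherwise. A word acts on \<open>1\<close> from its right end,
  so it survives only if it is a final segment of \<open>ls\<close>. Among the words of full length only \<open>ls\<close>
  itself survives.
\<close>

lemma detect_word:
  "\<exists>A. \<forall>ws. length ws \<le> length ls \<longrightarrow>
     action (prod_list (map A ws)) 1 =
       (if ws = drop (length ls - length ws) ls then monom 1 (length ws) else 0)"
proof -
  let ?d = "length ls"
  have "\<forall>a. \<exists>f. \<forall>j<?d. action f (monom 1 j) =
      (if a = ls ! (?d - Suc j) then monom 1 (Suc j) else 0)"
    by (intro allI partial_shift)
  then obtain A where "\<forall>a. \<forall>j<?d. action (A a) (monom 1 j) =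
      (if a = ls ! (?d - Suc j) then monom 1 (Suc j) else 0)"
    unfolding choice_iff by (rule exE)
  hence A: "action (A a) (monom 1 j) =
      (if a = ls ! (?d - Suc j) then monom 1 (Suc j) else 0)" if "j < ?d" for a j
    using that by blast
  have "action (prod_list (map A ws)) 1 =
      (if ws = drop (?d - length ws) ls then monom 1 (length ws) else 0)"
    if "length ws \<le> ?d" for ws
    using that
  proof (induction ws)
    case Nil
    show ?case by (simp add: action_one)
  next
    case (Cons a ws)
    have "drop (?d - length (a # ws)) ls = ls ! (?d - Suc (length ws)) # drop (?d - length ws) ls"
      using Cons.prems Cons_nth_drop_Suc[of "?d - Suc (length ws)" ls] by (simp add: Suc_diff_Suc)
    moreover have "action (prod_list (map A (a # ws))) 1 =
        (if ws = drop (?d - length ws) ls then action (A a) (monom 1 (length ws)) else 0)"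
      using Cons by (simp add: action_mult)
    ultimately show ?case using Cons.prems A[of "length ws" a]
      by (cases "a = ls ! (?d - Suc (length ws))") simp_all
  qed
  thus ?thesis by (intro exI[of _ A] allI impI)
qed

text \<open>
  Choose values that detect a word \<open>w\<close> that has the coefficient \<open>1\<close> and maximal length \<open>d\<close>. The shorter words contribute
  powers of \<open>t\<close> of smaller degree, the other words of length \<open>d\<close> contribute nothing, and so \<open>t ^ d\<close>
  has the coefficient \<open>1\<close> in the result.
\<close>

lemma monic_not_identity:
  assumes "nc_monic g"
  shows "\<exists>A. action (type_eval A g) 1 \<noteq> 0"
proof -
  obtain w where w: "w \<in> Poly_Mapping.keys g" "Poly_Mapping.lookup g w = 1"
    and max: "\<And>v. v \<in> Poly_Mapping.keys g \<Longrightarrow> length (letters v) \<le> length (letters w)"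
    using assms unfolding nc_monic_def by blast
  let ?d = "length (letters w)"
  obtain A where A: "\<And>ws. length ws \<le> ?d \<Longrightarrow> action (prod_list (map A ws)) 1 =
       (if ws = drop (?d - length ws) (letters w) then monom 1 (length ws) else 0)"
    using detect_word[of "letters w"] by blast
  have of_int: "action (of_int c * f) p = smult (of_int c) (action f p)" for c f p
    using action_scalar[of "of_int c" "action f p"] by (simp add: action_mult scalar_def)
  have coeff: "coeff (action (prod_list (map A (letters v))) 1) ?d = (if v = w then 1 else 0)"
    if "v \<in> Poly_Mapping.keys g" for v
  proof (cases "length (letters v) = ?d")
    case True
    moreover have "letters v = letters w \<longleftrightarrow> v = w"
      by (cases v; cases w) simp
    ultimately show ?thesis using A[of "letters v"] by simp
  next
    case False
    thus ?thesis using A[OF max[OF that]] by auto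
  qed
  have "coeff (action (type_eval A g) 1) ?d =
      (\<Sum>v\<in>Poly_Mapping.keys g. of_int (Poly_Mapping.lookup g v) * (if v = w then 1 else 0))"
    by (simp add: type_eval_def linear_extension_def action_sum of_int coeff_sum coeff cong: sum.cong)
  also have "\<dots> = (\<Sum>v\<in>Poly_Mapping.keys g. if v = w then 1 else 0)"
    using w by (intro sum.cong) auto
  also have "\<dots> = 1" using w by simp
  finally have "action (type_eval A g) 1 \<noteq> 0" by (intro notI) simp
  thus ?thesis by blast
qed

end

lemma (in quantum_plane_action) not_PI_ring_quotient:
  assumes J: "ideal J ring_of_type_algebra" and annihilates: "J \<subseteq> {f. \<forall>p. action f p = 0}"
  shows "\<not> PI_ring (ring_of_type_algebra Quot J)"
proof -
  interpret J: two_sided_ideal J by (rule two_sided_ideal.intro) (rule J)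
  show ?thesis
  proof
    assume "PI_ring J.quotient_ring"
    then obtain g :: "(nat, int) free_algebra" where
      g: "nc_monic g" "\<And>A. type_eval A g \<in> J"
      unfolding J.PI_ring_quotient_iff by blast
    obtain A where "action (type_eval A g) 1 \<noteq> 0"
      using monic_not_identity[OF g(1)] by blast
    with g(2)[of A] annihilates show False by blast
  qed
qed

section \<open>Polynomial identities of quantum matrices\<close>

definition plane_operator :: "'k :: Fields.field \<Rightarrow> generator \<Rightarrow> generator \<Rightarrow> 'k poly \<Rightarrow> 'k poly"
  where "plane_operator q y g p =
    (if g = G11 then pCons 0 p else if g = y then pcompose p [:0, q:] else 0)"

lemma quantum_plane_action_plane_operator:
  assumes "q \<noteq> 0" "\<And>n. n > 0 \<Longrightarrow> q ^ n \<noteq> 1" "y \<noteq> G11"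
  shows "quantum_plane_action (plane_operator q y) q G11 y"
proof
  fix j
  have "pcompose (monom 1 j) [:0, q:] = smult (q ^ j) (monom 1 j)"
    by (induction j) (simp_all add: monom_Suc pcompose_pCons one_pCons mult.commute)
  thus "plane_operator q y y (monom 1 j) = smult (q ^ j) (monom 1 j)"
    using assms(3) by (simp add: plane_operator_def)
qed (use assms in \<open>simp_all add: plane_operator_def pcompose_add pcompose_smult\<close>)

text \<open>
  Besides \<open>X11\<close> and \<open>y\<close> the generators act as \<open>0\<close>, which leaves a single relation that is not
  trivially satisfied: the one between \<open>X11\<close> and \<open>y\<close>, with the parameter \<open>q\<close>.
\<close>

lemma not_PI_ring_M2:
  fixes \<alpha> \<beta> :: "'k :: Fields.field"
  assumes q: "q \<noteq> 0" "\<And>n. n > 0 \<Longrightarrow> q ^ n \<noteq> 1"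
    and y: "(y, q) = (G12, \<alpha>) \<or> (y, q) = (G21, \<beta>)"
  shows "\<not> PI_ring (M2 \<alpha> \<beta>)"
proof -
  interpret F: ring "ring_of_type_algebra :: (generator, 'k) free_algebra ring"
    by (rule ring_free_algebra)
  interpret quantum_plane_action "plane_operator q y" q G11 y
    by (rule quantum_plane_action_plane_operator) (use q y in auto)
  have "M2_relations \<alpha> \<beta> \<subseteq> {f. \<forall>p. action f p = 0}"
    by (simp add: M2_relations_def Let_def action_diff action_mult action_letter action_scalar
          plane_operator_def)
       (use y in \<open>auto simp: pcompose_pCons\<close>)
  hence "Idl\<^bsub>ring_of_type_algebra\<^esub> (M2_relations \<alpha> \<beta>) \<subseteq> {f. \<forall>p. action f p = 0}"
    by (rule F.genideal_minimal[OF ideal_annihilator])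
  thus ?thesis
    unfolding M2_def Let_def by (intro not_PI_ring_quotient F.genideal_ideal) simp_all
qed

lemma PI_ring_M2_at_roots_of_unity:
  fixes \<alpha> \<beta> :: "'k :: Fields.field"
  assumes "\<alpha> \<noteq> 0" and n: "n > 0" "\<alpha> ^ n = 1" "\<beta> ^ n = 1"
  shows "PI_ring (M2 \<alpha> \<beta>)"
proof -
  interpret F: ring "ring_of_type_algebra :: (generator, 'k) free_algebra ring"
    by (rule ring_free_algebra)
  interpret quantum_matrix_ideal "Idl\<^bsub>ring_of_type_algebra\<^esub> (M2_relations \<alpha> \<beta>)" \<alpha> \<beta>
  proof (intro quantum_matrix_ideal.intro free_algebra_ideal.intro two_sided_ideal.intro
      quantum_matrix_ideal_axioms.intro)
    show "ideal (Idl\<^bsub>ring_of_type_algebra\<^esub> (M2_relations \<alpha> \<beta>)) ring_of_type_algebra"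
      by (rule F.genideal_ideal) simp
    show "M2_relations \<alpha> \<beta> \<subseteq> Idl\<^bsub>ring_of_type_algebra\<^esub> (M2_relations \<alpha> \<beta>)"
      by (rule F.genideal_self) simp
    show "\<alpha> \<noteq> 0" by (rule assms(1))
  qed
  show ?thesis
    using PI_ring_roots_of_unity[OF n] by (simp add: M2_def Let_def)
qed

theorem proposition4p4:
  fixes \<alpha> \<beta> :: "'k :: alg_closed_field"
  assumes "\<alpha> \<noteq> 0" and "\<beta> \<noteq> 0"
  shows "PI_ring (M2 \<alpha> \<beta>) \<longleftrightarrow> (\<exists>n>0. \<alpha> ^ n = 1) \<and> (\<exists>n>0. \<beta> ^ n = 1)"
proof
  assume "PI_ring (M2 \<alpha> \<beta>)"
  thus "(\<exists>n>0. \<alpha> ^ n = 1) \<and> (\<exists>n>0. \<beta> ^ n = 1)"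
    using not_PI_ring_M2[of \<alpha> G12 \<alpha> \<beta>] not_PI_ring_M2[of \<beta> G21 \<alpha> \<beta>] assms by blast
next
  assume "(\<exists>n>0. \<alpha> ^ n = 1) \<and> (\<exists>n>0. \<beta> ^ n = 1)"
  then obtain m n where mn: "m > 0" "\<alpha> ^ m = 1" "n > 0" "\<beta> ^ n = 1" by blast
  have "\<alpha> ^ (m * n) = 1" using mn by (simp add: power_mult)
  moreover have "\<beta> ^ (m * n) = 1" using mn by (simp add: power_mult mult.commute[of m])
  ultimately show "PI_ring (M2 \<alpha> \<beta>)"
    using PI_ring_M2_at_roots_of_unity[of \<alpha> "m * n" \<beta>] assms(1) mn by simp
qed

end
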